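(* For any $r$-graph $H$ and any positive integer $n$, ${\rm ex}(n,H) \geq \frac{\chi(L(H))-1}{n} \binom{n}{r}$.
   Context: An $r$-graph is an $r$-uniform hypergraph. The line graph $L(H)$ of an $r$-graph $H$ is the graph whose vertices are the edges of $H$, with two edges $e',e''$ adjacent when $|e'\cap e''|=r-1$; $\chi$ denotes chromatic number. An $r$-graph $G$ is $H$-free if it has no subgraph isomorphic to $H$; ${\rm ex}(n,H)$ is the maximum number of edges in an $H$-free $r$-graph on $n$ vertices.
   Formalization: The formal theorem adds the assumption that χ(L(H)) ≤ n+1 whenever r ≤ n; without it the bound exceeds C(n,r) and is false (e.g. r=2, H=K_{1,4}, n=2, where ex=1 < 3/2), so only false instances are excluded. *)

theory Defs
  imports Complex_Main "HOL-Library.FuncSet" "HOL-Library.Ramsey"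
begin

record 'a hypergraph =
  verts :: "'a set"
  edges :: "'a set set"

definition r_graph :: "nat \<Rightarrow> 'a hypergraph \<Rightarrow> bool" where
  "r_graph r G \<longleftrightarrow> finite (verts G) \<and> edges G \<subseteq> nsets (verts G) r"

definition subgraph :: "'a hypergraph \<Rightarrow> 'a hypergraph \<Rightarrow> bool" where
  "subgraph K G \<longleftrightarrow>
     verts K \<subseteq> verts G \<and> edges K \<subseteq> edges G \<and> edges K \<subseteq> Pow (verts K)"

definition isomorphic :: "'a hypergraph \<Rightarrow> 'b hypergraph \<Rightarrow> bool" where
  "isomorphic H K \<longleftrightarrow>
     (\<exists>f. bij_betw f (verts H) (verts K) \<and> edges K = (\<lambda>e. f ` e) ` edges H)"

text \<open>Freeness refers to arbitrary subgraphs, not only induced ones.\<close>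

definition free_of :: "'b hypergraph \<Rightarrow> 'a hypergraph \<Rightarrow> bool" where
  "free_of G H \<longleftrightarrow> (\<nexists>K. subgraph K G \<and> isomorphic H K)"

text \<open>Every finite r-graph has a copy with vertices in \<^typ>\<open>nat\<close>, so
  it suffices to range over those. If no r-graph on n vertices is free of H, which happens
  only when H has no edges and at most n vertices, the value is 0 because
  \<^term>\<open>Sup {} = (0::nat)\<close>; otherwise the supremum is the maximum.\<close>

definition ex_number :: "nat \<Rightarrow> nat \<Rightarrow> 'a hypergraph \<Rightarrow> nat" where
  "ex_number r n H =
     Sup {card (edges G) | G :: nat hypergraph.
            r_graph r G \<and> card (verts G) = n \<and> free_of G H}"

text \<open>The line graph is itself a 2-graph. Edges are taken distinct explicitly, so that there
  are no loops when \<open>r = 0\<close>, where \<open>r - 1\<close> truncates.\<close>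

definition line_graph :: "nat \<Rightarrow> 'a hypergraph \<Rightarrow> 'a set hypergraph" where
  "line_graph r H =
     \<lparr>verts = edges H,
      edges = {{e, f} | e f. e \<in> edges H \<and> f \<in> edges H \<and> e \<noteq> f \<and> card (e \<inter> f) = r - 1}\<rparr>"

definition proper_colouring :: "'a hypergraph \<Rightarrow> nat \<Rightarrow> ('a \<Rightarrow> nat) \<Rightarrow> bool" where
  "proper_colouring G k c \<longleftrightarrow>
     c \<in> verts G \<rightarrow> {..<k} \<and> (\<forall>x y. {x, y} \<in> edges G \<longrightarrow> c x \<noteq> c y)"

text \<open>Meant for finite loopless 2-graphs; the null graph has chromatic number 0.\<close>

definition chromatic_number :: "'a hypergraph \<Rightarrow> nat" where
  "chromatic_number G = (LEAST k. \<exists>c. proper_colouring G k c)"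

end

(* Colour the r-subsets of {..<n} by the residue of their element sum mod n. Two r-sets sharing
   r - 1 elements get different colours, so the union G of any k colour classes has a k-colourable
   line graph; for k < chi(L(H)) it is therefore H-free. Taking the k largest of the n classes
   gives at least k/n of all r-sets, and k = chi(L(H)) - 1 is the bound. *)
theory Submission
  imports Defs
begin

text \<open>Discarding a smallest element never lowers the average, so discarding smallest elements
  until \<open>k\<close> remain leaves a set whose average is at least that of \<open>A\<close>.
  Multiplying out avoids division by \<open>k\<close> or \<open>card A\<close>.\<close>

lemma exists_subset_sum_ge_average:
  fixes a :: "'a \<Rightarrow> real"
  assumes "finite A" "k \<le> card A"
  shows "\<exists>S\<subseteq>A. card S = k \<and> real k * sum a A \<le> real (card A) * sum a S"
  using assms
proof (induction "card A" arbitrary: A)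
  case 0
  then show ?case by auto
next
  case (Suc m)
  show ?case
  \<comment> \<open>Past this case \<open>k \<le> m\<close>, so the induction hypothesis applies
    after one removal, and \<open>m > 0\<close>, so the factor \<open>real m\<close> can be
    cancelled at the end.\<close>
  proof (cases "k = Suc m \<or> m = 0")
    case True
    then consider "k = card A" | "k = 0" using Suc by linarith
    then show ?thesis
    proof cases
      case 1
      then show ?thesis by (intro exI[of _ A]) simp
    next
      case 2
      then show ?thesis by (intro exI[of _ "{}"]) simp
    qed
  next
    case False
    have "A \<noteq> {}" using Suc.hyps(2) by auto
    then obtain x where x: "x \<in> A" "\<And>y. y \<in> A \<Longrightarrow> a x \<le> a y"
      using arg_min_if_finite[OF Suc.prems(1), of a] not_le by blast
    let ?B = "A - {x}"
    have cB: "card ?B = m" using x(1) Suc by simp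
    then obtain S where S: "S \<subseteq> ?B" "card S = k" "real k * sum a ?B \<le> real m * sum a S"
      using Suc.hyps(1)[of ?B] Suc False by auto
    have "real m * a x \<le> sum a ?B"
      using sum_bounded_below[of ?B "a x" a] x(2) cB by simp
    moreover have "sum a A = a x + sum a ?B"
      using x(1) Suc.prems(1) by (rule sum.remove[rotated])
    ultimately have "real m * sum a A \<le> real (Suc m) * sum a ?B"
      by (simp add: algebra_simps)
    then have "real k * (real m * sum a A) \<le> real k * (real (Suc m) * sum a ?B)"
      by (intro mult_left_mono) auto
    also have "\<dots> \<le> real (Suc m) * (real m * sum a S)"
      using mult_left_mono[OF S(3), of "real (Suc m)"] by (simp add: mult.left_commute)
    finally have "real m * (real k * sum a A) \<le> real m * (real (Suc m) * sum a S)"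
      by (simp only: mult.left_commute)
    then have "real k * sum a A \<le> real (Suc m) * sum a S"
      using False by (subst (asm) mult_le_cancel_left_pos) auto
    then show ?thesis using S(1,2) Suc.hyps(2) by auto
  qed
qed

text \<open>Such sets differ by exchanging one element \<open>x\<close> for another
  \<open>y\<close>, so their sums differ by \<open>x - y\<close>, which is nonzero and less than
  \<open>n\<close> in absolute value.\<close>

lemma sum_mod_neq_if_nearly_equal:
  fixes A B :: "nat set"
  assumes A: "A \<in> nsets {..<n} r" and B: "B \<in> nsets {..<n} r"
    and "A \<noteq> B" and I: "card (A \<inter> B) = r - 1"
  shows "\<Sum>A mod n \<noteq> \<Sum>B mod n"
proof
  assume eq: "\<Sum>A mod n = \<Sum>B mod n"
  have f: "finite A" "finite B" "card A = r" "card B = r" "A \<subseteq> {..<n}" "B \<subseteq> {..<n}"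
    using A B by (auto simp: nsets_def)
  \<comment> \<open>For \<open>r = 0\<close> both sets would be empty, hence equal; so
    \<open>r - 1\<close> does not truncate.\<close>
  have "r > 0" using f \<open>A \<noteq> B\<close> by (cases r) auto
  then have "card (A - B) = 1" "card (B - A) = 1"
    using f I by (auto simp: card_Diff_subset_Int Int_commute)
  then obtain x y where x: "A - B = {x}" and y: "B - A = {y}"
    by (auto simp: card_1_singleton_iff)
  have "A = insert x (A \<inter> B)" "B = insert y (A \<inter> B)" "x \<notin> A \<inter> B" "y \<notin> A \<inter> B"
    using x y by blast+
  then have sums: "\<Sum>A = x + \<Sum>(A \<inter> B)" "\<Sum>B = y + \<Sum>(A \<inter> B)"
    using f(1) by (metis finite_Int sum.insert)+
  \<comment> \<open>Over the integers the difference of the sums may be negative without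
    truncating.\<close>
  have "int (\<Sum>A) mod int n = int (\<Sum>B) mod int n"
    using eq by (metis of_nat_mod)
  then have "int n dvd int (\<Sum>A) - int (\<Sum>B)"
    by (simp only: mod_eq_dvd_iff)
  then have "int n dvd int x - int y"
    by (simp only: sums) simp
  moreover have "x < n" "y < n" using f x y by auto
  ultimately have "x = y" using dvd_imp_le_int[of "int x - int y" "int n"] by linarith
  then show False using x y by blast
qed

definition residue_graph :: "nat \<Rightarrow> nat \<Rightarrow> nat set \<Rightarrow> nat hypergraph" where
  "residue_graph n r S = \<lparr>verts = {..<n}, edges = {e \<in> nsets {..<n} r. \<Sum>e mod n \<in> S}\<rparr>"

text \<open>A copy of \<open>H\<close> pulls the residue colouring back to the edges of
  \<open>H\<close>. The embedding is injective, so it preserves intersection sizes, and the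
  pulled-back colouring is proper on the line graph.\<close>

lemma chromatic_number_le_if_not_free:
  assumes H: "r_graph r H" and "finite S" and nf: "\<not> free_of (residue_graph n r S) H"
  shows "chromatic_number (line_graph r H) \<le> card S"
proof -
  obtain K where K: "subgraph K (residue_graph n r S)" "isomorphic H K"
    using nf by (auto simp: free_of_def)
  then obtain f where f: "bij_betw f (verts H) (verts K)" "edges K = (\<lambda>e. f ` e) ` edges H"
    unfolding isomorphic_def by blast
  then have inj: "inj_on f (verts H)" by (simp add: bij_betw_def)
  have emb: "f ` e \<in> edges (residue_graph n r S)" if "e \<in> edges H" for e
    using K(1) f(2) that by (auto simp: subgraph_def)
  \<comment> \<open>Renumbers the residues in \<open>S\<close>, since
    \<open>proper_colouring\<close> wants colours below \<open>card S\<close>.\<close>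
  obtain h where h: "bij_betw h S {..<card S}"
    using ex_bij_betw_finite_nat[OF \<open>finite S\<close>] by (auto simp: atLeast0LessThan)
  define c where "c e = h (\<Sum>(f ` e) mod n)" for e
  have res: "f ` e \<in> nsets {..<n} r \<and> \<Sum>(f ` e) mod n \<in> S" if "e \<in> edges H" for e
    using emb[OF that] by (simp add: residue_graph_def)
  have "c e \<noteq> c e'"
    if e: "e \<in> edges H" "e' \<in> edges H" "e \<noteq> e'" "card (e \<inter> e') = r - 1" for e e'
  proof -
    have sub: "e \<subseteq> verts H" "e' \<subseteq> verts H"
      using H e by (auto simp: r_graph_def nsets_def)
    have "f ` e \<noteq> f ` e'" using inj sub e(3) by (simp add: inj_on_image_eq_iff)
    moreover have "card (f ` e \<inter> f ` e') = r - 1"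
      using inj_on_image_Int[OF inj sub] card_image[OF inj_on_subset[OF inj], of "e \<inter> e'"] sub e(4)
      by auto
    ultimately have "\<Sum>(f ` e) mod n \<noteq> \<Sum>(f ` e') mod n"
      using sum_mod_neq_if_nearly_equal res e by blast
    then show ?thesis
      using h res e unfolding c_def bij_betw_def inj_on_def by blast
  qed
  moreover have "c e < card S" if "e \<in> edges H" for e
    using h res[OF that] unfolding c_def bij_betw_def by auto
  ultimately have "proper_colouring (line_graph r H) (card S) c"
    unfolding proper_colouring_def line_graph_def
    by (simp add: doubleton_eq_iff Pi_iff) (metis Int_commute)
  then show ?thesis
    unfolding chromatic_number_def by (blast intro: Least_le)
qed

lemma card_edges_le_ex_number:
  fixes G :: "nat hypergraph"
  assumes "r_graph r G" "card (verts G) = n" "free_of G H"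
  shows "card (edges G) \<le> ex_number r n H"
proof -
  \<comment> \<open>A supremum of naturals dominates the members of the set only if the set is
    bounded; the number of all \<open>r\<close>-subsets is a bound.\<close>
  have "card (edges K) \<le> n choose r" if "r_graph r K" "card (verts K) = n" for K :: "nat hypergraph"
    using that card_mono[of "nsets (verts K) r" "edges K"]
    by (simp add: r_graph_def card_nsets finite_imp_finite_nsets)
  then have "bdd_above {card (edges G) | G :: nat hypergraph.
            r_graph r G \<and> card (verts G) = n \<and> free_of G H}"
    by (intro bdd_aboveI[of _ "n choose r"]) blast
  then show ?thesis
    unfolding ex_number_def using assms by (intro cSup_upper) auto
qed

lemma card_edges_residue_graph:
  assumes "finite S"
  shows "card (edges (residue_graph n r S)) = (\<Sum>c\<in>S. card {e \<in> nsets {..<n} r. \<Sum>e mod n = c})"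
proof -
  have "edges (residue_graph n r S) = (\<Union>c\<in>S. {e \<in> nsets {..<n} r. \<Sum>e mod n = c})"
    by (auto simp: residue_graph_def)
  then show ?thesis
    using assms by (simp add: card_UN_disjoint finite_imp_finite_nsets disjoint_iff)
qed

text \<open>Always ex(n,H) \<le> \<open>n choose r\<close>, which is positive for
  \<open>r \<le> n\<close>; there the bound can hold only if the chromatic number is at most
  \<open>n + 1\<close>, which is what the last hypothesis demands.\<close>

theorem theorem1:
  fixes H :: "'a hypergraph" and r n :: nat
  assumes "r_graph r H"
    and "n > 0"
    and "r \<le> n \<longrightarrow> chromatic_number (line_graph r H) \<le> n + 1"
  shows "real (ex_number r n H) \<ge>
           (real (chromatic_number (line_graph r H)) - 1) / real n * real (n choose r)"
proof (cases "r \<le> n \<and> chromatic_number (line_graph r H) > 0")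
  \<comment> \<open>The right-hand side is at most 0: either the binomial coefficient vanishes, or
    the chromatic number is 0 and the real factor is negative.\<close>
  case False
  then show ?thesis
    by (auto simp: not_le binomial_eq_0 intro: order_trans[of _ 0])
next
  case True
  then obtain k where k: "chromatic_number (line_graph r H) = Suc k" "k \<le> n"
    using assms(3) by (metis Suc_eq_plus1 Suc_le_mono gr0_implies_Suc)
  define a where "a c = real (card {e \<in> nsets {..<n} r. \<Sum>e mod n = c})" for c
  have edges: "real (card (edges (residue_graph n r S))) = sum a S" if "finite S" for S
    using card_edges_residue_graph[OF that, of n r] by (simp add: a_def)
  obtain S where S: "S \<subseteq> {..<n}" "card S = k" "real k * sum a {..<n} \<le> real n * sum a S"
    using exists_subset_sum_ge_average[of "{..<n}" k a] k(2) by auto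
  have fin: "finite S" using S(1) finite_subset by blast
  \<comment> \<open>As \<open>n > 0\<close>, every residue is below \<open>n\<close>, so the classes
    together contain all \<open>r\<close>-sets.\<close>
  have "edges (residue_graph n r {..<n}) = nsets {..<n} r"
    using \<open>n > 0\<close> by (simp add: residue_graph_def)
  then have total: "sum a {..<n} = real (n choose r)"
    using edges[of "{..<n}"] by (simp add: card_nsets)
  \<comment> \<open>Otherwise \<open>Suc k\<close>, the chromatic number, would be at most
    \<open>card S = k\<close>.\<close>
  have "free_of (residue_graph n r S) H"
    using chromatic_number_le_if_not_free[OF assms(1) fin] k(1) S(2) by force
  then have "card (edges (residue_graph n r S)) \<le> ex_number r n H"
    by (intro card_edges_le_ex_number) (auto simp: r_graph_def residue_graph_def)
  then have "sum a S \<le> real (ex_number r n H)"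
    using edges[OF fin] by linarith
  moreover have "real k / real n * real (n choose r) \<le> sum a S"
    using S(3) total \<open>n > 0\<close> by (simp add: field_simps)
  ultimately show ?thesis using k(1) by simp
qed

end
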